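(* For all integers $k_1,k_2\ge 0$, the sum $\sum_{\mu} a_{k_1+\frac12}(\mu)\, a_{k_2+\frac12}(\mu)$ (over all integer partitions $\mu$) is the number of $(k_1+1)$-connecting set partitions of $[k_1+k_2+1]$.
   Context: $[k]=\{1,2,\dots,k\}$. Integer partitions are identified with their Young diagrams and ordered by containment; $\emptyset$ is the only partition of $0$. A limiting vacillating tableau of shape $\mu$ and length $2k+1$ is a sequence of $2k+2$ integer partitions $(\mu^{(0)}=\emptyset,\mu^{(1/2)},\mu^{(1)},\dots,\mu^{(k)},\mu^{(k+1/2)}=\mu)$ such that (a) for each integer $j=0,\dots,k$: $\mu^{(j)}\supseteq\mu^{(j+1/2)}$ and $|\mu^{(j)}/\mu^{(j+1/2)}|\in\{0,1\}$; (b) for each integer $j=0,\dots,k-1$: $\mu^{(j+1/2)}\subseteq\mu^{(j+1)}$ and $|\mu^{(j+1)}/\mu^{(j+1/2)}|=1$. $a_{k+\frac12}(\mu)$ is the number of limiting vacillating tableaux of shape $\mu$ and length $2k+1$. For positive integers $\ell\le k$, a set partition of $[k]$ is $\ell$-connecting if every block $X$ satisfies $\min(X)\le\ell\le\max(X)$. *)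

theory Defs
  imports "HOL-Library.Disjoint_Sets" "HOL-Analysis.Infinite_Sum"
begin

definition integer_partition :: "nat list \<Rightarrow> bool" where
  "integer_partition \<mu> \<longleftrightarrow> sorted_wrt (\<ge>) \<mu> \<and> (\<forall>p\<in>set \<mu>. p > 0)"

(* Cells are numbered from 0: cell (i, j) lies in row i and column j. *)
definition young_diagram :: "nat list \<Rightarrow> (nat \<times> nat) set" where
  "young_diagram \<mu> = {(i, j). i < length \<mu> \<and> j < \<mu> ! i}"

definition contained :: "nat list \<Rightarrow> nat list \<Rightarrow> bool" where
  "contained \<mu> \<nu> \<longleftrightarrow> young_diagram \<mu> \<subseteq> young_diagram \<nu>"

(* The size of the skew shape \<nu>/\<mu>; used only when \<mu> is contained in \<nu>. *)
definition skew_size :: "nat list \<Rightarrow> nat list \<Rightarrow> nat" where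
  "skew_size \<nu> \<mu> = card (young_diagram \<nu> - young_diagram \<mu>)"

(* The partition at half-integer time t is stored at list position 2 * t:
   T ! (2 * j) is the partition at time j and T ! (2 * j + 1) the one at time j + 1/2. *)
definition limiting_vacillating_tableau :: "nat \<Rightarrow> nat list \<Rightarrow> nat list list \<Rightarrow> bool" where
  "limiting_vacillating_tableau k \<mu> T \<longleftrightarrow>
     length T = 2 * k + 2 \<and>
     (\<forall>\<nu>\<in>set T. integer_partition \<nu>) \<and>
     T ! 0 = [] \<and>
     T ! (2 * k + 1) = \<mu> \<and>
     (\<forall>j\<le>k. contained (T ! (2 * j + 1)) (T ! (2 * j)) \<and>
            skew_size (T ! (2 * j)) (T ! (2 * j + 1)) \<in> {0, 1}) \<and>
     (\<forall>j<k. contained (T ! (2 * j + 1)) (T ! (2 * (j + 1))) \<and>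
            skew_size (T ! (2 * (j + 1))) (T ! (2 * j + 1)) = 1)"

(* num_tableaux k \<mu> is the number of tableaux of length 2 * k + 1, i.e. a with index k + 1/2. *)
definition num_tableaux :: "nat \<Rightarrow> nat list \<Rightarrow> nat" where
  "num_tableaux k \<mu> = card {T. limiting_vacillating_tableau k \<mu> T}"

definition connecting :: "nat \<Rightarrow> nat set set \<Rightarrow> bool" where
  "connecting l P \<longleftrightarrow> (\<forall>X\<in>P. Min X \<le> l \<and> l \<le> Max X)"

end

theory Submission
  imports Defs "HOL-Combinatorics.Stirling"
begin

text \<open>
  In Young's lattice let \<open>f(\<mu>)\<close> be the number of saturated chains from \<open>\<emptyset>\<close> to \<open>\<mu>\<close>, that is, the
  number of standard Young tableaux of shape \<open>\<mu>\<close>. The lattice is a differential poset: a shape has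
  one more upper cover than it has lower covers, and two different shapes have as many common upper
  as common lower covers. Hence the operators \<open>U\<close> (add a box) and \<open>D\<close> (delete a box) satisfy
  \<open>DU - UD = 1\<close> (\<open>sum_upper_lower_commute\<close>). Two classical facts follow: the values of \<open>f\<close> at the
  shapes that cover \<open>\<mu>\<close> sum to \<open>(|\<mu>| + 1) f(\<mu>)\<close>, and the squares \<open>f(\<mu>)\<^sup>2\<close> over the shapes of
  size \<open>n\<close> sum to \<open>n!\<close>.

  The first step of a limiting vacillating tableau cannot change \<open>\<emptyset>\<close>; the remaining ones are a
  way to apply \<open>(1 + D) U\<close> \<open>k\<close> times, with \<open>U\<close> acting first. Let \<open>S(n, m)\<close> be the
  Stirling numbers of the second kind. On the vector with entries \<open>f(\<mu>)\<close> at the shapes of size \<open>m\<close>,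
  \<open>U\<close> raises \<open>m\<close> by one, and \<open>DU\<close> multiplies by \<open>m + 1\<close>. The coefficient of this vector therefore
  obeys the Stirling recurrence, and the number of tableaux of shape \<open>\<mu>\<close> is
  \<open>S(k + 1, |\<mu>| + 1) f(\<mu>)\<close> (\<open>num_tableaux_eq\<close>). Summing over all \<open>\<mu>\<close> gives
  \[ \sum_j S(k_1 + 1, j + 1) \, S(k_2 + 1, j + 1) \, j! \]

  The same sum counts connecting partitions. Put \<open>l = k\<^sub>1 + 1\<close>. A partition of the whole interval is
  \<open>l\<close>-connecting iff every block meets both \<open>A = {1..l}\<close> and \<open>B = {l..k\<^sub>1 + k\<^sub>2 + 1}\<close>. Such a
  partition is determined by its restrictions to \<open>A\<close> and to \<open>B\<close>, which have equally many blocks,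
  say \<open>j + 1\<close>, and by the bijection between their blocks that says which ones are glued. The two
  blocks that contain the common point \<open>l\<close> must be glued; the others can be matched in \<open>j!\<close> ways
  (\<open>card_linked_partitions\<close>).
\<close>

section \<open>Young's lattice\<close>

text \<open>
  Shapes are handled as finite down-sets of cells. Unions and intersections of shapes, which the
  comparison of common covers needs, are then literally unions and intersections.
\<close>

definition diagram :: "(nat \<times> nat) set \<Rightarrow> bool" where
  "diagram S \<longleftrightarrow> finite S \<and> (\<forall>i j i' j'. (i, j) \<in> S \<longrightarrow> i' \<le> i \<longrightarrow> j' \<le> j \<longrightarrow> (i', j') \<in> S)"

definition upper :: "(nat \<times> nat) set \<Rightarrow> (nat \<times> nat) set set" where
  "upper S = {T. diagram T \<and> (\<exists>c. c \<notin> S \<and> T = insert c S)}"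

definition lower :: "(nat \<times> nat) set \<Rightarrow> (nat \<times> nat) set set" where
  "lower T = {S. diagram S \<and> (\<exists>c. c \<notin> S \<and> T = insert c S)}"

lemma diagram_empty [simp]: "diagram {}"
  by (simp add: diagram_def)

lemma diagram_finite: "diagram S \<Longrightarrow> finite S"
  by (simp add: diagram_def)

lemma diagram_Un: "diagram S \<Longrightarrow> diagram T \<Longrightarrow> diagram (S \<union> T)"
  unfolding diagram_def by (metis Un_iff finite_Un)

lemma diagram_Int: "diagram S \<Longrightarrow> diagram T \<Longrightarrow> diagram (S \<inter> T)"
  unfolding diagram_def by (metis Int_iff finite_Int)

lemma lower_iff_upper: "diagram S \<Longrightarrow> diagram T \<Longrightarrow> S \<in> lower T \<longleftrightarrow> T \<in> upper S"
  by (simp add: lower_def upper_def)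

lemma upper_cell: "T \<in> upper S \<Longrightarrow> \<exists>c. c \<notin> S \<and> T = insert c S"
  by (simp add: upper_def)

lemma lower_cell: "S \<in> lower T \<Longrightarrow> \<exists>c. c \<notin> S \<and> T = insert c S"
  by (simp add: lower_def)

lemma upperD: "T \<in> upper S \<Longrightarrow> diagram T"
  by (simp add: upper_def)

lemma lowerD: "S \<in> lower T \<Longrightarrow> diagram S"
  by (simp add: lower_def)

lemma card_upper: "diagram S \<Longrightarrow> T \<in> upper S \<Longrightarrow> card T = Suc (card S)"
  by (auto simp: upper_def diagram_finite)

lemma card_lower: "S \<in> lower T \<Longrightarrow> card T = Suc (card S)"
  by (auto simp: lower_def diagram_finite)

lemma lower_empty [simp]: "lower {} = {}"
  by (simp add: lower_def)

lemma finite_lower: 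
  assumes "diagram T" shows "finite (lower T)"
proof (rule finite_subset)
  show "lower T \<subseteq> Pow T" by (auto simp: lower_def)
qed (simp add: diagram_finite assms)

lemma diagram_rows:
  assumes "diagram S"
  obtains r :: "nat \<Rightarrow> nat" where "antimono r" "S = {(i, j). j < r i}"
proof -
  define r where "r i = (LEAST j. (i, j) \<notin> S)" for i
  have fin: "finite S" using assms by (rule diagram_finite)
  have ex: "\<exists>j. (i, j) \<notin> S" for i
  proof (rule ccontr)
    assume "\<not> ?thesis"
    then have "Pair i ` UNIV \<subseteq> S" by auto
    moreover have "infinite (Pair i ` (UNIV :: nat set))"
      by (simp add: finite_image_iff inj_on_def)
    ultimately show False using fin finite_subset by blast
  qed
  have iff: "(i, j) \<in> S \<longleftrightarrow> j < r i" for i j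
  proof
    assume "(i, j) \<in> S"
    moreover have "(i, r i) \<notin> S" unfolding r_def by (rule LeastI_ex[OF ex])
    ultimately show "j < r i"
      using assms unfolding diagram_def by (meson le_refl not_le)
  next
    assume "j < r i"
    then show "(i, j) \<in> S" unfolding r_def using not_less_Least by blast
  qed
  have "antimono r"
  proof (rule antimonoI)
    fix x y :: nat assume "x \<le> y"
    show "r y \<le> r x"
    proof (rule ccontr)
      assume "\<not> r y \<le> r x"
      then have "(y, r x) \<in> S" by (simp add: iff)
      then have "(x, r x) \<in> S" using assms \<open>x \<le> y\<close> unfolding diagram_def by blast
      then show False by (simp add: iff)
    qed
  qed
  moreover have "S = {(i, j). j < r i}" using iff by auto
  ultimately show thesis by (rule that)
qed

text \<open>
  A cell further to the right would leave a gap in its row, and no row may outgrow the row above it.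
\<close>

lemma addable_cell_iff:
  assumes r: "antimono r" and S: "diagram S" "S = {(i, j). j < r i}"
  shows "diagram (insert (i, j) S) \<and> (i, j) \<notin> S \<longleftrightarrow> j = r i \<and> (i = 0 \<or> r i < r (i - 1))"
proof
  assume L: "diagram (insert (i, j) S) \<and> (i, j) \<notin> S"
  then have j: "r i \<le> j" using S by auto
  have "j = r i"
  proof (rule ccontr)
    assume "j \<noteq> r i"
    moreover have "(i, r i) \<in> insert (i, j) S"
      using L j unfolding diagram_def by blast
    ultimately show False using S by auto
  qed
  moreover have "r i < r (i - 1)" if "i \<noteq> 0"
  proof -
    have "(i - 1, j) \<in> insert (i, j) S"
      using L unfolding diagram_def by (metis diff_le_self insertI1 le_refl)
    then show ?thesis using that S \<open>j = r i\<close> by auto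
  qed
  ultimately show "j = r i \<and> (i = 0 \<or> r i < r (i - 1))" by blast
next
  assume R: "j = r i \<and> (i = 0 \<or> r i < r (i - 1))"
  have "(i', j') \<in> insert (i, j) S"
    if "(a, b) \<in> insert (i, j) S" "i' \<le> a" "j' \<le> b" for a b i' j'
  proof (cases "(a, b) \<in> S")
    case True
    then show ?thesis using S(1) that unfolding diagram_def by blast
  next
    case False
    then have ab: "a = i" "b = j" using that by auto
    show ?thesis
    proof (cases "i' = i")
      case True
      then show ?thesis using that ab R S by auto
    next
      case False
      then have "i' \<le> i - 1" "i \<noteq> 0" using that ab by auto
      then have "r (i - 1) \<le> r i'" using r antimonoD by blast
      then show ?thesis using that ab R S \<open>i \<noteq> 0\<close> by auto
    qed
  qed
  moreover have "finite (insert (i, j) S)" using S(1) diagram_finite by auto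
  ultimately show "diagram (insert (i, j) S) \<and> (i, j) \<notin> S"
    using R S unfolding diagram_def by auto
qed

text \<open>
  Any other cell has a right or a lower neighbour, which a down-set cannot keep without it.
\<close>

lemma removable_cell_iff:
  assumes r: "antimono r" and S: "diagram S" "S = {(i, j). j < r i}"
  shows "diagram (S - {(i, j)}) \<and> (i, j) \<in> S \<longleftrightarrow> j = r i - 1 \<and> r (Suc i) < r i"
proof
  assume L: "diagram (S - {(i, j)}) \<and> (i, j) \<in> S"
  then have j: "j < r i" using S by auto
  have "j = r i - 1"
  proof (rule ccontr)
    assume "j \<noteq> r i - 1"
    then have "(i, r i - 1) \<in> S - {(i, j)}" "j \<le> r i - 1" using j S by auto
    then have "(i, j) \<in> S - {(i, j)}"
      using L unfolding diagram_def by blast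
    then show False by simp
  qed
  moreover have "\<not> j < r (Suc i)"
  proof
    assume "j < r (Suc i)"
    then have "(Suc i, j) \<in> S - {(i, j)}" using S by auto
    moreover have "i \<le> Suc i" by simp
    ultimately have "(i, j) \<in> S - {(i, j)}" using L unfolding diagram_def by blast
    then show False by simp
  qed
  ultimately show "j = r i - 1 \<and> r (Suc i) < r i" using j by auto
next
  assume R: "j = r i - 1 \<and> r (Suc i) < r i"
  have "(i', j') \<noteq> (i, j)" if ab: "(a, b) \<in> S - {(i, j)}" "i' \<le> a" "j' \<le> b" for a b i' j'
  proof
    assume eq: "(i', j') = (i, j)"
    show False
    proof (cases "a = i")
      case True
      then show False using ab eq R S by auto
    next
      case False
      then have "Suc i \<le> a" using ab eq by auto
      then have "r a \<le> r (Suc i)" using r antimonoD by blast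
      then show False using ab eq R S by auto
    qed
  qed
  then have "diagram (S - {(i, j)})"
    using S(1) unfolding diagram_def by (metis Diff_iff finite_Diff singletonD)
  then show "diagram (S - {(i, j)}) \<and> (i, j) \<in> S" using R S by auto
qed

text \<open>
  A cell is removable from row \<open>i\<close> iff one is addable to row \<open>i + 1\<close>: both say that row \<open>i + 1\<close>
  is strictly shorter than row \<open>i\<close>. The additional addable cell is the one in row \<open>0\<close>.
\<close>

lemma
  assumes S: "diagram S"
  shows finite_upper: "finite (upper S)"
    and card_upper_eq_Suc_card_lower: "card (upper S) = Suc (card (lower S))"
proof -
  obtain r where r: "antimono r" "S = {(i, j). j < r i}"
    using diagram_rows[OF S] by blast
  define D where "D = {i. r (Suc i) < r i}"
  have finD: "finite D"
  proof (rule finite_subset)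
    show "D \<subseteq> fst ` S"
    proof
      fix i assume "i \<in> D"
      then have "(i, 0) \<in> S" using r(2) by (auto simp: D_def)
      then show "i \<in> fst ` S" by force
    qed
  qed (use S diagram_finite in auto)
  have add: "{i. i = 0 \<or> r i < r (i - 1)} = insert 0 (Suc ` D)" (is "?A = _")
  proof (rule set_eqI)
    fix i show "i \<in> ?A \<longleftrightarrow> i \<in> insert 0 (Suc ` D)"
      by (cases i) (auto simp: D_def)
  qed
  have up: "upper S = (\<lambda>i. insert (i, r i) S) ` insert 0 (Suc ` D)"
  proof (rule set_eqI)
    fix T
    have "T \<in> upper S \<longleftrightarrow>
        (\<exists>i j. T = insert (i, j) S \<and> diagram (insert (i, j) S) \<and> (i, j) \<notin> S)"
      unfolding upper_def by auto
    then show "T \<in> upper S \<longleftrightarrow> T \<in> (\<lambda>i. insert (i, r i) S) ` insert 0 (Suc ` D)"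
      unfolding addable_cell_iff[OF r(1) S r(2)] add[symmetric] by blast
  qed
  have low: "lower S = (\<lambda>i. S - {(i, r i - 1)}) ` D"
  proof (rule set_eqI)
    fix T
    have "T \<in> lower S \<longleftrightarrow> (\<exists>i j. T = S - {(i, j)} \<and> diagram (S - {(i, j)}) \<and> (i, j) \<in> S)"
    proof
      assume "T \<in> lower S"
      then obtain i j where T: "diagram T" and ij: "(i, j) \<notin> T" "S = insert (i, j) T"
        unfolding lower_def by auto
      then have eq: "T = S - {(i, j)}" by simp
      show "\<exists>i j. T = S - {(i, j)} \<and> diagram (S - {(i, j)}) \<and> (i, j) \<in> S"
        using T ij(2) unfolding eq[symmetric] by (metis eq insertI1)
    next
      assume "\<exists>i j. T = S - {(i, j)} \<and> diagram (S - {(i, j)}) \<and> (i, j) \<in> S"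
      then obtain i j where eq: "T = S - {(i, j)}" and "diagram T" "(i, j) \<in> S" by auto
      moreover from this have "(i, j) \<notin> T" "S = insert (i, j) T" by (simp_all add: insert_absorb)
      ultimately show "T \<in> lower S" unfolding lower_def by simp metis
    qed
    then show "T \<in> lower S \<longleftrightarrow> T \<in> (\<lambda>i. S - {(i, r i - 1)}) ` D"
      unfolding removable_cell_iff[OF r(1) S r(2)] by (simp add: D_def image_iff Bex_def conj_commute)
  qed
  have inj_up: "inj_on (\<lambda>i. insert (i, r i) S) (insert 0 (Suc ` D))"
  proof (rule inj_onI)
    fix x y assume "insert (x, r x) S = insert (y, r y) S"
    moreover have "(x, r x) \<notin> S" using r(2) by auto
    ultimately show "x = y" by (metis Pair_inject insertE insertI1)
  qed
  have inj_low: "inj_on (\<lambda>i. S - {(i, r i - 1)}) D"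
  proof (rule inj_onI)
    fix x y assume "x \<in> D" "y \<in> D" "S - {(x, r x - 1)} = S - {(y, r y - 1)}"
    moreover have "(x, r x - 1) \<in> S" using r(2) \<open>x \<in> D\<close> by (auto simp: D_def)
    ultimately show "x = y" by blast
  qed
  show "finite (upper S)" unfolding up using finD by simp
  have "card (upper S) = card (insert 0 (Suc ` D))"
    unfolding up by (rule card_image[OF inj_up])
  also have "\<dots> = Suc (card D)"
    using finD by (simp add: card_insert_if image_iff card_image)
  also have "card D = card (lower S)"
    unfolding low by (rule card_image[OF inj_low, symmetric])
  finally show "card (upper S) = Suc (card (lower S))" .
qed

text \<open>
  A common upper cover of \<open>S \<noteq> T\<close> can only be \<open>S \<union> T\<close> and a common lower cover can only be
  \<open>S \<inter> T\<close>. These are covers under the same condition, namely that \<open>S - T\<close> and \<open>T - S\<close> are single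
  cells, so both counts are \<open>1\<close> or both are \<open>0\<close>.
\<close>

lemma common_covers:
  assumes S: "diagram S" and T: "diagram T" and ne: "S \<noteq> T"
  shows "card (upper S \<inter> upper T) = card (lower S \<inter> lower T)"
proof (cases "\<exists>c d. S - T = {c} \<and> T - S = {d}")
  case True
  then obtain c d where cd: "S - T = {c}" "T - S = {d}" by blast
  have "S \<union> T = insert d S" "S \<union> T = insert c T" "S = insert c (S \<inter> T)" "T = insert d (S \<inter> T)"
    "c \<notin> T" "d \<notin> S" using cd by blast+
  then have "S \<union> T \<in> upper S \<inter> upper T" "S \<inter> T \<in> lower S \<inter> lower T"
    using diagram_Un[OF S T] diagram_Int[OF S T] unfolding upper_def lower_def by blast+
  moreover have "U = S \<union> T" if "U \<in> upper S \<inter> upper T" for U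
  proof -
    have "U \<in> upper S" "U \<in> upper T" using that by simp_all
    then obtain a b where "a \<notin> S" "U = insert a S" "b \<notin> T" "U = insert b T"
      by (meson upper_cell)
    moreover from this ne have "a \<noteq> b" by (metis insert_ident)
    ultimately have "a \<in> T" "T \<subseteq> U" by auto
    with \<open>U = insert a S\<close> \<open>U = insert b T\<close> \<open>a \<noteq> b\<close> show ?thesis by auto
  qed
  moreover have "U = S \<inter> T" if "U \<in> lower S \<inter> lower T" for U
  proof -
    have "U \<in> lower S" "U \<in> lower T" using that by simp_all
    then obtain a b where "a \<notin> U" "S = insert a U" "b \<notin> U" "T = insert b U"
      by (meson lower_cell)
    with ne show ?thesis by blast
  qed
  ultimately have "upper S \<inter> upper T = {S \<union> T}" "lower S \<inter> lower T = {S \<inter> T}" by blast+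
  then show ?thesis by simp
next
  case False
  have "U \<notin> upper S \<inter> upper T" for U
  proof
    assume "U \<in> upper S \<inter> upper T"
    then have "U \<in> upper S" "U \<in> upper T" by simp_all
    then obtain c d where "c \<notin> S" "U = insert c S" "d \<notin> T" "U = insert d T"
      by (meson upper_cell)
    moreover from this ne have "c \<noteq> d" by (metis insert_ident)
    ultimately have "S - T = {d}" "T - S = {c}" by auto
    then show False using False by blast
  qed
  moreover have "U \<notin> lower S \<inter> lower T" for U
  proof
    assume "U \<in> lower S \<inter> lower T"
    then have "U \<in> lower S" "U \<in> lower T" by simp_all
    then obtain c d where "c \<notin> U" "S = insert c U" "d \<notin> U" "T = insert d U"
      by (meson lower_cell)
    then have "S - T = {c}" "T - S = {d}" using ne by blast+
    then show False using False by blast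
  qed
  ultimately have "upper S \<inter> upper T = {}" "lower S \<inter> lower T = {}" by blast+
  then show ?thesis by simp
qed

text \<open>
  The relation \<open>DU = 1 + UD\<close>. On either side the coefficient of \<open>g R\<close> is a number of common covers
  of \<open>S\<close> and \<open>R\<close>; the two agree for \<open>R \<noteq> S\<close> and differ by one for \<open>R = S\<close>.
\<close>

lemma sum_upper_lower_commute:
  fixes g :: "(nat \<times> nat) set \<Rightarrow> nat"
  assumes S: "diagram S"
  shows "(\<Sum>T\<in>upper S. \<Sum>R\<in>lower T. g R) = g S + (\<Sum>T\<in>lower S. \<Sum>R\<in>upper T. g R)"
proof -
  \<comment> \<open>A finite set that contains every shape reached from \<open>S\<close> by one step up and one step down, in either order.\<close>
  define X where "X = insert S ((\<Union>T\<in>upper S. lower T) \<union> (\<Union>T\<in>lower S. upper T))"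
  have fin: "finite (upper S)" "finite (lower S)"
    using finite_upper finite_lower S by blast+
  have finX: "finite X"
    unfolding X_def using fin finite_upper finite_lower lowerD upperD by blast
  have X: "diagram R" if "R \<in> X" for R
    using that S lowerD upperD unfolding X_def by blast
  have "(\<Sum>T\<in>upper S. \<Sum>R\<in>lower T. g R) = (\<Sum>T\<in>upper S. \<Sum>R | R \<in> X \<and> T \<in> upper R. g R)"
  proof (rule sum.cong[OF refl], rule sum.cong[OF _ refl])
    fix T assume T: "T \<in> upper S"
    show "lower T = {R \<in> X. T \<in> upper R}"
    proof (intro set_eqI iffI)
      fix R assume R: "R \<in> lower T"
      then have "R \<in> X" using T unfolding X_def by blast
      moreover have "T \<in> upper R"
        using R lower_iff_upper[OF lowerD[OF R] upperD[OF T]] by simp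
      ultimately show "R \<in> {R \<in> X. T \<in> upper R}" by simp
    next
      fix R assume "R \<in> {R \<in> X. T \<in> upper R}"
      then show "R \<in> lower T" using lower_iff_upper[OF X upperD[OF T]] by simp
    qed
  qed
  also have "\<dots> = (\<Sum>R\<in>X. \<Sum>T | T \<in> upper S \<and> T \<in> upper R. g R)"
    by (rule sum.swap_restrict[OF fin(1) finX])
  also have "\<dots> = (\<Sum>R\<in>X. card (upper S \<inter> upper R) * g R)"
    by (simp add: Int_def)
  also have "\<dots> = card (upper S) * g S + (\<Sum>R\<in>X - {S}. card (upper S \<inter> upper R) * g R)"
    using finX by (subst sum.remove[of X S]) (auto simp: X_def)
  also have "(\<Sum>R\<in>X - {S}. card (upper S \<inter> upper R) * g R)
      = (\<Sum>R\<in>X - {S}. card (lower S \<inter> lower R) * g R)"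
    by (rule sum.cong[OF refl]) (use common_covers[OF S] X in auto)
  also have "card (upper S) * g S + \<dots> = g S + (\<Sum>R\<in>X. card (lower S \<inter> lower R) * g R)"
    using finX card_upper_eq_Suc_card_lower[OF S] by (subst sum.remove[of X S]) (auto simp: X_def)
  also have "(\<Sum>R\<in>X. card (lower S \<inter> lower R) * g R)
      = (\<Sum>R\<in>X. \<Sum>T | T \<in> lower S \<and> T \<in> lower R. g R)"
    by (simp add: Int_def)
  also have "\<dots> = (\<Sum>T\<in>lower S. \<Sum>R | R \<in> X \<and> T \<in> lower R. g R)"
    by (rule sum.swap_restrict[OF fin(2) finX, symmetric])
  also have "\<dots> = (\<Sum>T\<in>lower S. \<Sum>R\<in>upper T. g R)"
  proof (rule sum.cong[OF refl], rule sum.cong[OF _ refl])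
    fix T assume T: "T \<in> lower S"
    show "{R \<in> X. T \<in> lower R} = upper T"
    proof (intro set_eqI iffI)
      fix R assume R: "R \<in> upper T"
      then have "R \<in> X" using T unfolding X_def by blast
      moreover have "T \<in> lower R"
        using R lower_iff_upper[OF lowerD[OF T] upperD[OF R]] by simp
      ultimately show "R \<in> {R \<in> X. T \<in> lower R}" by simp
    next
      fix R assume "R \<in> {R \<in> X. T \<in> lower R}"
      then show "R \<in> upper T" using lower_iff_upper[OF lowerD[OF T] X[of R]] by simp
    qed
  qed
  finally show ?thesis .
qed

section \<open>Counting saturated chains\<close>

text \<open>
  For \<open>n = card S\<close> this is the number of standard Young tableaux of shape \<open>S\<close>. The length is a
  separate argument so that the recursion is primitive; the value is \<open>0\<close> for every other length.
\<close>

primrec num_chains :: "nat \<Rightarrow> (nat \<times> nat) set \<Rightarrow> nat" where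
  "num_chains 0 S = (if S = {} then 1 else 0)"
| "num_chains (Suc n) S = (\<Sum>T\<in>lower S. num_chains n T)"

text \<open>
  The identity \<open>D U\<^sup>n\<^sup>+\<^sup>1 \<emptyset> = (n + 1) U\<^sup>n \<emptyset>\<close>: each commutation of \<open>D\<close> past a \<open>U\<close> leaves one copy of
  \<open>U\<^sup>n \<emptyset>\<close>, and finally \<open>D \<emptyset> = 0\<close>.
\<close>

lemma sum_upper_chains:
  "diagram S \<Longrightarrow> (\<Sum>T\<in>upper S. num_chains (Suc n) T) = Suc n * num_chains n S"
proof (induction n arbitrary: S)
  case 0
  have "(\<Sum>T\<in>lower S. \<Sum>R\<in>upper T. num_chains 0 R) = 0"
    by (intro sum.neutral ballI) (auto simp: upper_def)
  then show ?case
    using sum_upper_lower_commute[OF 0, of "num_chains 0"] by simp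
next
  case (Suc n)
  have "(\<Sum>T\<in>upper S. num_chains (Suc (Suc n)) T)
      = num_chains (Suc n) S + (\<Sum>T\<in>lower S. \<Sum>R\<in>upper T. num_chains (Suc n) R)"
    unfolding num_chains.simps(2)[of "Suc n"] by (rule sum_upper_lower_commute[OF Suc.prems])
  also have "(\<Sum>T\<in>lower S. \<Sum>R\<in>upper T. num_chains (Suc n) R) = (\<Sum>T\<in>lower S. Suc n * num_chains n T)"
    by (rule sum.cong[OF refl]) (use Suc.IH lowerD in blast)
  also have "\<dots> = Suc n * num_chains (Suc n) S"
    by (simp add: sum_distrib_left)
  finally show ?case by simp
qed

text \<open>
  A shape of size \<open>n\<close> fits into an \<open>n \<times> n\<close> square, because with a cell it contains the whole row
  segment to the left of the cell and the whole column segment above it.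
\<close>

lemma finite_diagrams_of_card: "finite {S. diagram S \<and> card S = n}"
proof (rule finite_subset)
  show "{S. diagram S \<and> card S = n} \<subseteq> Pow ({..<n} \<times> {..<n})"
  proof (clarsimp)
    fix S i j assume S: "diagram S" "(i, j) \<in> S" 
    have fin: "finite S" using S diagram_finite by blast
    have "(\<lambda>a. (a, j)) ` {..i} \<subseteq> S" "(\<lambda>b. (i, b)) ` {..j} \<subseteq> S"
      using S unfolding diagram_def by blast+
    then have "card ((\<lambda>a. (a, j)) ` {..i}) \<le> card S" "card ((\<lambda>b. (i, b)) ` {..j}) \<le> card S"
      using fin by (auto intro: card_mono)
    then show "i < card S \<and> j < card S" by (simp add: card_image inj_on_def)
  qed
qed simp

text \<open>
  Expanding one factor over the lower covers moves a box from one side of the inner product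
  \<open>\<langle>U\<^sup>n\<^sup>+\<^sup>1 \<emptyset>, U\<^sup>n\<^sup>+\<^sup>1 \<emptyset>\<rangle>\<close> to the other, where \<open>sum_upper_chains\<close> turns it into the factor \<open>n + 1\<close>.
\<close>

lemma sum_chains_squared:
  "(\<Sum>S | diagram S \<and> card S = n. num_chains n S * num_chains n S) = fact n"
proof (induction n)
  case 0
  have "{S. diagram S \<and> card S = 0} = {{}}"
    using diagram_finite by auto
  then show ?case by simp
next
  case (Suc n)
  let ?L = "\<lambda>n. {S. diagram S \<and> card S = n}"
  have "(\<Sum>T\<in>?L (Suc n). num_chains (Suc n) T * num_chains (Suc n) T)
      = (\<Sum>T\<in>?L (Suc n). \<Sum>S | S \<in> ?L n \<and> T \<in> upper S. num_chains n S * num_chains (Suc n) T)"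
  proof (rule sum.cong[OF refl])
    fix T assume T: "T \<in> ?L (Suc n)"
    have "lower T = {S \<in> ?L n. T \<in> upper S}"
    proof (intro set_eqI iffI)
      fix S assume S: "S \<in> lower T"
      then have "T \<in> upper S" using T lower_iff_upper[OF lowerD[OF S]] by simp
      then show "S \<in> {S \<in> ?L n. T \<in> upper S}"
        using T lowerD[OF S] card_lower[OF S] by simp
    next
      fix S assume "S \<in> {S \<in> ?L n. T \<in> upper S}"
      then show "S \<in> lower T" using T lower_iff_upper[of S T] by simp
    qed
    then show "num_chains (Suc n) T * num_chains (Suc n) T
        = (\<Sum>S | S \<in> ?L n \<and> T \<in> upper S. num_chains n S * num_chains (Suc n) T)"
      by (simp add: sum_distrib_right)
  qed
  also have "\<dots> = (\<Sum>S\<in>?L n. \<Sum>T | T \<in> ?L (Suc n) \<and> T \<in> upper S. num_chains n S * num_chains (Suc n) T)"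
    by (rule sum.swap_restrict[OF finite_diagrams_of_card finite_diagrams_of_card])
  also have "\<dots> = (\<Sum>S\<in>?L n. Suc n * (num_chains n S * num_chains n S))"
  proof (rule sum.cong[OF refl])
    fix S assume S: "S \<in> ?L n"
    have "{T \<in> ?L (Suc n). T \<in> upper S} = upper S"
      using S upperD card_upper by auto
    then have "(\<Sum>T | T \<in> ?L (Suc n) \<and> T \<in> upper S. num_chains n S * num_chains (Suc n) T)
        = num_chains n S * (\<Sum>T\<in>upper S. num_chains (Suc n) T)"
      by (simp only: sum_distrib_left)
    also have "\<dots> = num_chains n S * (Suc n * num_chains n S)"
      using sum_upper_chains S by simp
    finally show "(\<Sum>T | T \<in> ?L (Suc n) \<and> T \<in> upper S. num_chains n S * num_chains (Suc n) T)
        = Suc n * (num_chains n S * num_chains n S)" by (simp only: ac_simps)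
  qed
  also have "\<dots> = Suc n * fact n"
    by (simp only: sum_distrib_left[symmetric] Suc.IH)
  finally show ?case by simp
qed

section \<open>Partitions and their diagrams\<close>

lemma young_diagram_Sigma: "young_diagram \<mu> = (SIGMA i:{..<length \<mu>}. {..<\<mu> ! i})"
  by (auto simp: young_diagram_def)

text \<open>
  The parts of a partition are positive, so its length is the length of the first column of its
  diagram, and the parts themselves are the row lengths. Conversely the nonzero row lengths of a
  finite down-set form a partition.
\<close>

lemma young_diagram_bij: "bij_betw young_diagram {\<mu>. integer_partition \<mu>} {S. diagram S}"
  unfolding bij_betw_def
proof (intro conjI inj_onI equalityI subsetI)
  fix \<mu> \<nu> :: "nat list"
  assume part: "\<mu> \<in> {\<mu>. integer_partition \<mu>}" "\<nu> \<in> {\<mu>. integer_partition \<mu>}"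
    and eq: "young_diagram \<mu> = young_diagram \<nu>"
  have "i < length \<kappa> \<longleftrightarrow> (i, 0) \<in> young_diagram \<kappa>" if "integer_partition \<kappa>" for i \<kappa>
    using that by (auto simp: young_diagram_def integer_partition_def)
  then have "i < length \<mu> \<longleftrightarrow> i < length \<nu>" for i using part eq by auto
  then have len: "length \<mu> = length \<nu>" by (metis linorder_neq_iff)
  show "\<mu> = \<nu>"
  proof (rule nth_equalityI[OF len])
    fix i assume "i < length \<mu>"
    then have "j < \<mu> ! i \<longleftrightarrow> j < \<nu> ! i" for j
      using eq len unfolding young_diagram_def set_eq_iff by auto
    then show "\<mu> ! i = \<nu> ! i" by (metis linorder_neq_iff)
  qed
next
  fix S assume "S \<in> young_diagram ` {\<mu>. integer_partition \<mu>}"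
  then obtain \<mu> where mu: "integer_partition \<mu>" and S: "S = young_diagram \<mu>" by auto
  have "\<mu> ! i \<le> \<mu> ! i'" if "i' \<le> i" "i < length \<mu>" for i i'
    using that mu unfolding integer_partition_def
    by (cases "i' = i") (auto simp: sorted_wrt_iff_nth_less)
  then have "(i', j') \<in> S" if "(i, j) \<in> S" "i' \<le> i" "j' \<le> j" for i j i' j'
    using that unfolding S young_diagram_def by fastforce
  moreover have "finite S" unfolding S young_diagram_Sigma by simp
  ultimately show "S \<in> {S. diagram S}" unfolding diagram_def by blast
next
  fix S :: "(nat \<times> nat) set" assume "S \<in> {S. diagram S}"
  then have dia: "diagram S" by simp
  then obtain r where r: "antimono r" "S = {(i, j). j < r i}" by (rule diagram_rows)
  have "\<exists>i. r i = 0"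
  proof (rule ccontr)
    assume "\<nexists>i. r i = 0"
    then have "(\<lambda>i. (i, 0)) ` UNIV \<subseteq> S" using r(2) by auto
    moreover have "infinite ((\<lambda>i. (i, 0 :: nat)) ` (UNIV :: nat set))"
      by (simp add: finite_image_iff inj_on_def)
    ultimately show False using diagram_finite[OF dia] finite_subset by blast
  qed
  define n where "n = (LEAST i. r i = 0)"
  have n: "r i > 0 \<longleftrightarrow> i < n" for i
  proof
    assume "r i > 0"
    moreover have "r n = 0" unfolding n_def by (rule LeastI_ex) fact
    ultimately show "i < n" using antimonoD[OF r(1), of n i] by force
  next
    assume "i < n"
    then show "r i > 0" unfolding n_def using not_less_Least by blast
  qed
  have "integer_partition (map r [0..<n])"
    unfolding integer_partition_def
  proof
    show "sorted_wrt (\<ge>) (map r [0..<n])"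
      unfolding sorted_wrt_iff_nth_less using antimonoD[OF r(1)] by simp
    show "\<forall>p\<in>set (map r [0..<n]). p > 0" using n by simp
  qed
  moreover have "young_diagram (map r [0..<n]) = S"
  proof -
    have "(i, j) \<in> young_diagram (map r [0..<n]) \<longleftrightarrow> j < r i" for i j
      using n[of i] by (cases "i < n") (simp_all add: young_diagram_def)
    then show ?thesis unfolding r(2) by auto
  qed
  ultimately show "S \<in> young_diagram ` {\<mu>. integer_partition \<mu>}" by (metis imageI mem_Collect_eq)
qed

lemma young_diagram_diagram: "integer_partition \<mu> \<Longrightarrow> diagram (young_diagram \<mu>)"
  using young_diagram_bij unfolding bij_betw_def by blast

lemma young_diagram_eq_iff:
  "integer_partition \<mu> \<Longrightarrow> integer_partition \<nu> \<Longrightarrow> young_diagram \<mu> = young_diagram \<nu> \<longleftrightarrow> \<mu> = \<nu>"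
  using young_diagram_bij unfolding bij_betw_def inj_on_def by blast

lemma integer_partition_Nil [simp]: "integer_partition []"
  by (simp add: integer_partition_def)

lemma young_diagram_Nil [simp]: "young_diagram [] = {}"
  by (simp add: young_diagram_def)

section \<open>Counting limiting vacillating tableaux\<close>

definition add_box :: "nat list \<Rightarrow> nat list \<Rightarrow> bool" where
  "add_box \<kappa> \<nu> \<longleftrightarrow> contained \<kappa> \<nu> \<and> skew_size \<nu> \<kappa> = 1"

definition keep_or_delete_box :: "nat list \<Rightarrow> nat list \<Rightarrow> bool" where
  "keep_or_delete_box \<nu> \<mu> \<longleftrightarrow> contained \<mu> \<nu> \<and> skew_size \<nu> \<mu> \<in> {0, 1}"

lemma add_box_iff:
  assumes "integer_partition \<kappa>" "integer_partition \<nu>"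
  shows "add_box \<kappa> \<nu> \<longleftrightarrow> young_diagram \<kappa> \<in> lower (young_diagram \<nu>)"
proof -
  have "A \<subseteq> B \<and> card (B - A) = 1 \<longleftrightarrow> (\<exists>c. c \<notin> A \<and> B = insert c A)" for A B :: "(nat \<times> nat) set"
  proof
    assume AB: "A \<subseteq> B \<and> card (B - A) = 1"
    then obtain c where c: "B - A = {c}" by (auto simp: card_1_singleton_iff)
    then have "B = insert c A" "c \<notin> A" using AB by blast+
    then show "\<exists>c. c \<notin> A \<and> B = insert c A" by blast
  next
    assume "\<exists>c. c \<notin> A \<and> B = insert c A"
    then obtain c where c: "c \<notin> A" "B = insert c A" by metis
    then have "B - A = {c}" by (simp add: insert_Diff_if)
    then show "A \<subseteq> B \<and> card (B - A) = 1" using c by auto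
  qed
  then show ?thesis
    unfolding add_box_def contained_def skew_size_def lower_def
    using young_diagram_diagram[OF assms(1)] by simp
qed

lemma keep_or_delete_box_iff:
  assumes "integer_partition \<nu>" "integer_partition \<mu>"
  shows "keep_or_delete_box \<nu> \<mu> \<longleftrightarrow>
    young_diagram \<nu> \<in> insert (young_diagram \<mu>) (upper (young_diagram \<mu>))"
proof -
  note dia = young_diagram_diagram[OF assms(1)] young_diagram_diagram[OF assms(2)]
  have "keep_or_delete_box \<nu> \<mu> \<longleftrightarrow> young_diagram \<nu> = young_diagram \<mu> \<or> add_box \<mu> \<nu>"
    using diagram_finite[OF dia(1)]
    by (auto simp: keep_or_delete_box_def add_box_def contained_def skew_size_def)
  also have "\<dots> \<longleftrightarrow> young_diagram \<nu> \<in> insert (young_diagram \<mu>) (upper (young_diagram \<mu>))"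
    using add_box_iff[OF assms(2,1)] lower_iff_upper[OF dia(2,1)] by simp
  finally show ?thesis .
qed

lemma image_diagrams:
  assumes "X \<subseteq> {S. diagram S}"
  shows "young_diagram ` {\<nu>. integer_partition \<nu> \<and> young_diagram \<nu> \<in> X} = X"
proof (intro equalityI subsetI)
  fix S assume S: "S \<in> X"
  then have "S \<in> young_diagram ` {\<nu>. integer_partition \<nu>}"
    using assms young_diagram_bij unfolding bij_betw_def by blast
  then show "S \<in> young_diagram ` {\<nu>. integer_partition \<nu> \<and> young_diagram \<nu> \<in> X}"
    using S by blast
qed blast

lemma sum_over_partitions:
  assumes "X \<subseteq> {S. diagram S}"
  shows "(\<Sum>\<nu> | integer_partition \<nu> \<and> young_diagram \<nu> \<in> X. g (young_diagram \<nu>)) = sum g X"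
proof -
  have "inj_on young_diagram {\<nu>. integer_partition \<nu> \<and> young_diagram \<nu> \<in> X}"
    by (intro inj_onI) (use young_diagram_eq_iff in blast)
  then show ?thesis using sum.reindex[of young_diagram _ g] image_diagrams[OF assms]
    by (simp add: comp_def) metis
qed

lemma finite_partitions_over:
  assumes "X \<subseteq> {S. diagram S}" "finite X"
  shows "finite {\<nu>. integer_partition \<nu> \<and> young_diagram \<nu> \<in> X}"
proof -
  have "inj_on young_diagram {\<nu>. integer_partition \<nu> \<and> young_diagram \<nu> \<in> X}"
    by (intro inj_onI) (use young_diagram_eq_iff in blast)
  then show ?thesis using image_diagrams[OF assms(1)] assms(2) finite_image_iff by metis
qed

lemma tableau_iff_moves:
  "limiting_vacillating_tableau k \<mu> T \<longleftrightarrow>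
    length T = 2 * k + 2 \<and> (\<forall>\<nu>\<in>set T. integer_partition \<nu>) \<and> T ! 0 = [] \<and> T ! (2 * k + 1) = \<mu> \<and>
    (\<forall>j\<le>k. keep_or_delete_box (T ! (2 * j)) (T ! (2 * j + 1))) \<and>
    (\<forall>j<k. add_box (T ! (2 * j + 1)) (T ! (2 * (j + 1))))"
  by (simp only: limiting_vacillating_tableau_def add_box_def keep_or_delete_box_def)

lemma tableau_0:
  "limiting_vacillating_tableau 0 \<mu> T \<longleftrightarrow> \<mu> = [] \<and> T = [[], []]"
proof
  assume L: "limiting_vacillating_tableau 0 \<mu> T"
  then have "length T = 2" by (simp add: limiting_vacillating_tableau_def)
  then obtain a b where T: "T = [a, b]" by (auto simp: numeral_2_eq_2 length_Suc_conv)
  with L have "a = []" "b = \<mu>" "integer_partition \<mu>" "contained \<mu> []"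
    by (auto simp: limiting_vacillating_tableau_def)
  then have "young_diagram \<mu> = young_diagram []" by (auto simp: contained_def)
  then have "\<mu> = []" using young_diagram_eq_iff \<open>integer_partition \<mu>\<close> integer_partition_Nil by blast
  then show "\<mu> = [] \<and> T = [[], []]" using T \<open>a = []\<close> \<open>b = \<mu>\<close> by simp
qed (auto simp: limiting_vacillating_tableau_def contained_def skew_size_def)

text \<open>
  A longer tableau is a shorter one followed by its last two steps. This turns the count into a
  double sum over the two preceding shapes.
\<close>

lemma tableau_Suc:
  "limiting_vacillating_tableau (Suc k) \<mu> T \<longleftrightarrow>
    (\<exists>\<kappa> \<nu> T'. T = T' @ [\<nu>, \<mu>] \<and> limiting_vacillating_tableau k \<kappa> T' \<and>
      integer_partition \<nu> \<and> integer_partition \<mu> \<and> add_box \<kappa> \<nu> \<and> keep_or_delete_box \<nu> \<mu>)"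
  (is "?L \<longleftrightarrow> ?R")
proof -
  \<comment> \<open>The entries with index up to \<open>2 * k + 1\<close> all lie in \<open>T'\<close>, so only the last condition of each kind concerns the two new shapes.\<close>
  have split: "limiting_vacillating_tableau (Suc k) \<mu> (T' @ [\<nu>, \<rho>]) \<longleftrightarrow>
      \<rho> = \<mu> \<and> limiting_vacillating_tableau k (T' ! (2 * k + 1)) T' \<and>
      integer_partition \<nu> \<and> integer_partition \<mu> \<and>
      add_box (T' ! (2 * k + 1)) \<nu> \<and> keep_or_delete_box \<nu> \<mu>"
    if len: "length T' = 2 * k + 2" for T' \<nu> \<rho>
  proof -
    have 1: "(\<forall>j\<le>Suc k. P j) \<longleftrightarrow> (\<forall>j\<le>k. P j) \<and> P (Suc k)"
      "(\<forall>j<Suc k. P j) \<longleftrightarrow> (\<forall>j<k. P j) \<and> P k" for P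
      by (auto simp: le_Suc_eq less_Suc_eq)
    let ?T = "T' @ [\<nu>, \<rho>]"
    have a: "?T ! (2 * Suc k) = \<nu>" "?T ! (2 * Suc k + 1) = \<rho>" "?T ! 0 = T' ! 0"
      using len by (auto simp: nth_append)
    have b: "?T ! (2 * j) = T' ! (2 * j)" "?T ! (2 * j + 1) = T' ! (2 * j + 1)" if "j \<le> k" for j
      using len that by (auto simp: nth_append)
    have c: "?T ! (2 * (j + 1)) = T' ! (2 * (j + 1))" if "j < k" for j
      using len that by (auto simp: nth_append)
    have d: "?T ! (2 * (k + 1)) = \<nu>" using a by simp
    have e: "(\<forall>j\<le>k. keep_or_delete_box (?T ! (2 * j)) (?T ! (2 * j + 1))) \<longleftrightarrow>
        (\<forall>j\<le>k. keep_or_delete_box (T' ! (2 * j)) (T' ! (2 * j + 1)))"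
      using b by simp
    have "?T ! (2 * k + 1) = T' ! (2 * k + 1)" using b by simp
    moreover have "(\<forall>j<k. add_box (?T ! (2 * j + 1)) (?T ! (2 * (j + 1)))) \<longleftrightarrow>
        (\<forall>j<k. add_box (T' ! (2 * j + 1)) (T' ! (2 * (j + 1))))"
      using b c by simp
    moreover note d
    ultimately show ?thesis
      unfolding tableau_iff_moves 1 a e using len by auto
  qed
  show ?thesis
  proof
    assume L: ?L
    then have len: "length T = 2 * k + 4" by (simp add: limiting_vacillating_tableau_def)
    define T' where "T' = take (2 * k + 2) T"
    have "length (drop (2 * k + 2) T) = 2" using len by simp
    then obtain \<nu> \<rho> where "drop (2 * k + 2) T = [\<nu>, \<rho>]"
      by (metis (no_types) length_0_conv length_Suc_conv numeral_2_eq_2)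
    then have T: "T = T' @ [\<nu>, \<rho>]" unfolding T'_def by (metis append_take_drop_id)
    have "length T' = 2 * k + 2" unfolding T'_def using len by simp
    from split[OF this] L T show ?R by blast
  next
    assume ?R
    then obtain \<kappa> \<nu> T' where T: "T = T' @ [\<nu>, \<mu>]" "limiting_vacillating_tableau k \<kappa> T'"
      and R: "integer_partition \<nu>" "integer_partition \<mu>" "add_box \<kappa> \<nu>" "keep_or_delete_box \<nu> \<mu>"
      by blast
    have len: "length T' = 2 * k + 2" and "T' ! (2 * k + 1) = \<kappa>"
      using T(2) by (auto simp: limiting_vacillating_tableau_def)
    then show ?L using split[OF len, of \<nu> \<mu>] T R by simp
  qed
qed

lemma tableau_shape:
  assumes "limiting_vacillating_tableau k \<mu> T"
  shows "integer_partition \<mu>" "T \<noteq> []" "last T = \<mu>"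
proof -
  have T: "length T = 2 * k + 2" "T ! (2 * k + 1) = \<mu>" "\<forall>\<nu>\<in>set T. integer_partition \<nu>"
    using assms unfolding limiting_vacillating_tableau_def by simp_all
  then show "T \<noteq> []" "integer_partition \<mu>" by auto
  then show "last T = \<mu>" using T by (simp add: last_conv_nth)
qed

text \<open>
  The shape at time \<open>k + 1/2\<close> is the last entry of the shorter tableau, so decompositions for
  different shapes are different and the tableaux are counted by a disjoint sum. Finiteness is
  part of the statement because a cardinality over infinitely many tableaux would be \<open>0\<close>.
\<close>

lemma num_tableaux_Suc:
  assumes fin: "\<And>\<kappa>. finite {T. limiting_vacillating_tableau k \<kappa> T}" and \<mu>: "integer_partition \<mu>"
  shows "finite {T. limiting_vacillating_tableau (Suc k) \<mu> T}"
    and "num_tableaux (Suc k) \<mu> =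
      (\<Sum>\<nu> | integer_partition \<nu> \<and> keep_or_delete_box \<nu> \<mu>.
        \<Sum>\<kappa> | integer_partition \<kappa> \<and> add_box \<kappa> \<nu>. num_tableaux k \<kappa>)"
proof -
  let ?N = "{\<nu>. integer_partition \<nu> \<and> keep_or_delete_box \<nu> \<mu>}"
  let ?L = "\<lambda>\<nu>. {\<kappa>. integer_partition \<kappa> \<and> add_box \<kappa> \<nu>}"
  let ?T = "\<lambda>\<kappa>. {T. limiting_vacillating_tableau k \<kappa> T}"
  have eqN: "?N = {\<nu>. integer_partition \<nu> \<and>
      young_diagram \<nu> \<in> insert (young_diagram \<mu>) (upper (young_diagram \<mu>))}"
    using keep_or_delete_box_iff \<mu> by auto
  have finN: "finite ?N"
    unfolding eqN using young_diagram_diagram[OF \<mu>] finite_upper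
    by (intro finite_partitions_over) (auto dest: upperD)
  have finL: "finite (?L \<nu>)" if \<nu>: "\<nu> \<in> ?N" for \<nu>
  proof -
    have "?L \<nu> = {\<kappa>. integer_partition \<kappa> \<and> young_diagram \<kappa> \<in> lower (young_diagram \<nu>)}"
      using add_box_iff \<nu> by auto
    then show ?thesis
      using \<nu> finite_lower young_diagram_diagram
      by (auto intro!: finite_partitions_over dest: lowerD)
  qed
  let ?S = "SIGMA \<nu>:?N. SIGMA \<kappa>:?L \<nu>. ?T \<kappa>"
  have eq: "{T. limiting_vacillating_tableau (Suc k) \<mu> T} = (\<lambda>(\<nu>, \<kappa>, T). T @ [\<nu>, \<mu>]) ` ?S"
    unfolding tableau_Suc using \<mu> tableau_shape(1) by (force simp: image_iff)
  have inj: "inj_on (\<lambda>(\<nu>, \<kappa>, T). T @ [\<nu>, \<mu>]) ?S"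
    by (auto intro!: inj_onI) (metis tableau_shape(3))
  have finS: "finite ?S"
    using finN finL fin by (intro finite_SigmaI) auto
  show "finite {T. limiting_vacillating_tableau (Suc k) \<mu> T}"
    unfolding eq using finS by simp
  have "num_tableaux (Suc k) \<mu> = card ?S"
    unfolding num_tableaux_def eq by (rule card_image[OF inj])
  also have "\<dots> = (\<Sum>\<nu>\<in>?N. card (SIGMA \<kappa>:?L \<nu>. ?T \<kappa>))"
    using finN finL fin by (intro card_SigmaI) auto
  also have "\<dots> = (\<Sum>\<nu>\<in>?N. \<Sum>\<kappa>\<in>?L \<nu>. num_tableaux k \<kappa>)"
    unfolding num_tableaux_def using finL fin by (intro sum.cong[OF refl] card_SigmaI) auto
  finally show "num_tableaux (Suc k) \<mu> = (\<Sum>\<nu>\<in>?N. \<Sum>\<kappa>\<in>?L \<nu>. num_tableaux k \<kappa>)" .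
qed

lemma finite_tableaux: "finite {T. limiting_vacillating_tableau k \<mu> T}"
proof (induction k arbitrary: \<mu>)
  case 0
  then show ?case by (simp add: tableau_0)
next
  case (Suc k)
  show ?case
  proof (cases "integer_partition \<mu>")
    case True
    then show ?thesis using num_tableaux_Suc(1) Suc.IH by blast
  next
    case False
    then have "{T. limiting_vacillating_tableau (Suc k) \<mu> T} = {}" using tableau_shape(1) by blast
    then show ?thesis by simp
  qed
qed

text \<open>
  The steps into a shape \<open>\<nu>\<close> from its lower covers contribute \<open>S(k + 1, |\<nu>|) f(\<nu>)\<close>. Keeping
  \<open>\<nu> = \<mu>\<close> gives \<open>S(k + 1, |\<mu>|) f(\<mu>)\<close>, and deleting a box from the upper covers \<open>\<nu>\<close> of \<open>\<mu>\<close> gives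
  \<open>S(k + 1, |\<mu>| + 1) (|\<mu>| + 1) f(\<mu>)\<close>. The sum is the recurrence for \<open>S(k + 2, |\<mu>| + 1) f(\<mu>)\<close>.
\<close>

lemma num_tableaux_eq:
  assumes "integer_partition \<mu>"
  shows "num_tableaux k \<mu> = Stirling (Suc k) (Suc (card (young_diagram \<mu>))) *
    num_chains (card (young_diagram \<mu>)) (young_diagram \<mu>)"
  using assms
proof (induction k arbitrary: \<mu>)
  case 0
  show ?case
  proof (cases "\<mu> = []")
    case True
    then show ?thesis by (simp add: num_tableaux_def tableau_0)
  next
    case False
    then have "young_diagram \<mu> \<noteq> {}" using young_diagram_eq_iff[OF 0 integer_partition_Nil] by simp
    then have "card (young_diagram \<mu>) \<noteq> 0"
      using diagram_finite[OF young_diagram_diagram[OF 0]] by simp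
    then show ?thesis using False by (simp add: num_tableaux_def tableau_0)
  qed
next
  case (Suc k)
  let ?M = "young_diagram \<mu>"
  define m where "m = card ?M"
  have M: "diagram ?M" using young_diagram_diagram[OF Suc.prems] .
  have inner: "(\<Sum>\<kappa> | integer_partition \<kappa> \<and> add_box \<kappa> \<nu>. num_tableaux k \<kappa>)
      = Stirling (Suc k) (card (young_diagram \<nu>)) *
        num_chains (card (young_diagram \<nu>)) (young_diagram \<nu>)"
    if \<nu>: "integer_partition \<nu>" for \<nu>
  proof -
    let ?V = "young_diagram \<nu>"
    have "(\<Sum>\<kappa> | integer_partition \<kappa> \<and> add_box \<kappa> \<nu>. num_tableaux k \<kappa>)
        = (\<Sum>\<kappa> | integer_partition \<kappa> \<and> young_diagram \<kappa> \<in> lower ?V.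
          Stirling (Suc k) (Suc (card (young_diagram \<kappa>))) *
          num_chains (card (young_diagram \<kappa>)) (young_diagram \<kappa>))"
      by (rule sum.cong) (use add_box_iff \<nu> Suc.IH in auto)
    also have "\<dots> = (\<Sum>S\<in>lower ?V. Stirling (Suc k) (Suc (card S)) * num_chains (card S) S)"
      by (rule sum_over_partitions) (auto dest: lowerD)
    also have "\<dots> = Stirling (Suc k) (card ?V) * num_chains (card ?V) ?V"
    \<comment> \<open>The empty shape has no lower covers, in accordance with \<open>S(k + 1, 0) = 0\<close>.\<close>
    proof (cases "card ?V")
      case 0
      then have "?V = {}" using diagram_finite[OF young_diagram_diagram[OF \<nu>]] by simp
      then show ?thesis by simp
    next
      case (Suc n)
      then have "card S = n" if "S \<in> lower ?V" for S using card_lower[OF that] by simp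
      then show ?thesis using Suc by (simp add: sum_distrib_left)
    qed
    finally show ?thesis .
  qed
  have "num_tableaux (Suc k) \<mu> =
      (\<Sum>\<nu> | integer_partition \<nu> \<and> keep_or_delete_box \<nu> \<mu>.
        \<Sum>\<kappa> | integer_partition \<kappa> \<and> add_box \<kappa> \<nu>. num_tableaux k \<kappa>)"
    by (rule num_tableaux_Suc(2)[OF finite_tableaux Suc.prems])
  also have "\<dots> = (\<Sum>\<nu> | integer_partition \<nu> \<and> young_diagram \<nu> \<in> insert ?M (upper ?M).
      Stirling (Suc k) (card (young_diagram \<nu>)) *
        num_chains (card (young_diagram \<nu>)) (young_diagram \<nu>))"
    by (rule sum.cong) (use keep_or_delete_box_iff Suc.prems inner in auto)
  also have "\<dots> = (\<Sum>S\<in>insert ?M (upper ?M). Stirling (Suc k) (card S) * num_chains (card S) S)"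
    by (rule sum_over_partitions) (use M upperD in auto)
  also have "\<dots> = Stirling (Suc k) m * num_chains m ?M
      + (\<Sum>S\<in>upper ?M. Stirling (Suc k) (card S) * num_chains (card S) S)"
  proof -
    have "?M \<notin> upper ?M" using card_upper[OF M, of ?M] by auto
    then show ?thesis using finite_upper[OF M] by (simp add: m_def)
  qed
  also have "(\<Sum>S\<in>upper ?M. Stirling (Suc k) (card S) * num_chains (card S) S)
      = Stirling (Suc k) (Suc m) * (\<Sum>S\<in>upper ?M. num_chains (Suc m) S)"
    unfolding sum_distrib_left by (rule sum.cong) (use card_upper[OF M] in \<open>auto simp: m_def\<close>)
  also have "(\<Sum>S\<in>upper ?M. num_chains (Suc m) S) = Suc m * num_chains m ?M"
    by (rule sum_upper_chains[OF M])
  finally show ?case by (simp add: m_def algebra_simps)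
qed

text \<open>
  Tableaux of length \<open>2 k + 1\<close> have at most \<open>k\<close> boxes, so only finitely many shapes contribute. Over
  the shapes of a fixed size the Stirling factors are constant and \<open>f\<^sup>2\<close> sums to a factorial.
\<close>

lemma sum_num_tableaux:
  "((\<lambda>\<mu>. num_tableaux k \<mu> * num_tableaux l \<mu>) has_sum
     (\<Sum>j\<le>k. Stirling (Suc k) (Suc j) * Stirling (Suc l) (Suc j) * fact j)) {\<mu>. integer_partition \<mu>}"
proof (rule has_sum_finite_neutralI)
  let ?D = "{S. diagram S \<and> card S \<le> k}"
  let ?g = "\<lambda>S. Stirling (Suc k) (Suc (card S)) * Stirling (Suc l) (Suc (card S)) *
    (num_chains (card S) S * num_chains (card S) S)"
  have D: "?D = (\<Union>j\<in>{..k}. {S. diagram S \<and> card S = j})" by auto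
  have finD: "finite ?D" unfolding D using finite_diagrams_of_card by blast
  let ?B = "{\<mu>. integer_partition \<mu> \<and> young_diagram \<mu> \<in> ?D}"
  show "finite ?B" by (rule finite_partitions_over[OF _ finD]) auto
  show "?B \<subseteq> {\<mu>. integer_partition \<mu>}" by auto
  show "num_tableaux k \<mu> * num_tableaux l \<mu> = 0" if "\<mu> \<in> {\<mu>. integer_partition \<mu>} - ?B" for \<mu>
    using that young_diagram_diagram by (auto simp: num_tableaux_eq simp del: Stirling.simps)
  have "(\<Sum>\<mu>\<in>?B. num_tableaux k \<mu> * num_tableaux l \<mu>) = (\<Sum>\<mu>\<in>?B. ?g (young_diagram \<mu>))"
    by (rule sum.cong) (auto simp: num_tableaux_eq simp del: Stirling.simps)
  also have "\<dots> = sum ?g ?D" by (rule sum_over_partitions) auto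
  also have "\<dots> = (\<Sum>j\<le>k. \<Sum>S | diagram S \<and> card S = j. ?g S)"
    unfolding D using finite_diagrams_of_card by (intro sum.UNION_disjoint) auto
  also have "\<dots> = (\<Sum>j\<le>k. Stirling (Suc k) (Suc j) * Stirling (Suc l) (Suc j) * fact j)"
  proof (rule sum.cong[OF refl])
    fix j
    have "(\<Sum>S | diagram S \<and> card S = j. ?g S) = Stirling (Suc k) (Suc j) * Stirling (Suc l) (Suc j) *
        (\<Sum>S | diagram S \<and> card S = j. num_chains j S * num_chains j S)"
      unfolding sum_distrib_left by (rule sum.cong) auto
    then show "(\<Sum>S | diagram S \<and> card S = j. ?g S)
        = Stirling (Suc k) (Suc j) * Stirling (Suc l) (Suc j) * fact j"
      by (simp only: sum_chains_squared)
  qed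
  finally show "(\<Sum>j\<le>k. Stirling (Suc k) (Suc j) * Stirling (Suc l) (Suc j) * fact j)
    = (\<Sum>\<mu>\<in>?B. num_tableaux k \<mu> * num_tableaux l \<mu>)" by simp
qed

section \<open>Set partitions and Stirling numbers\<close>

lemma partition_on_block_unique:
  "partition_on A P \<Longrightarrow> X \<in> P \<Longrightarrow> Y \<in> P \<Longrightarrow> x \<in> X \<Longrightarrow> x \<in> Y \<Longrightarrow> X = Y"
  unfolding partition_on_def disjoint_def by (metis disjoint_iff)

lemma partition_on_insert_singleton:
  assumes "x \<notin> A"
  shows "partition_on (insert x A) (insert {x} Q) \<and> {x} \<notin> Q \<longleftrightarrow> partition_on A Q"
proof -
  have *: "disjnt {x} (\<Union>Q)"
    if P: "partition_on (insert x A) (insert {x} Q)" "{x} \<notin> Q"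
  proof -
    have "x \<notin> q" if "q \<in> Q" for q
      using partition_on_block_unique[OF P(1), of q "{x}" x] that P(2) by auto
    then show ?thesis by (simp add: disjnt_def)
  qed
  have **: "disjnt {x} (\<Union>Q) \<and> {x} \<notin> Q" if "partition_on A Q"
    using partition_onD1[OF that] assms by (auto simp: disjnt_def)
  have "insert x A - {x} = A" using assms by simp
  then have "partition_on (insert x A) (insert {x} Q) \<longleftrightarrow> partition_on A Q"
    if "disjnt {x} (\<Union>Q)"
    using partition_on_insert[OF that, of "insert x A"] by simp
  then show ?thesis using * ** by blast
qed

lemma partition_on_extend_block:
  assumes "x \<notin> A" "x \<notin> q" "q \<noteq> {}" "insert x q \<notin> R" "q \<notin> R"
  shows "partition_on (insert x A) (insert (insert x q) R) \<longleftrightarrow> partition_on A (insert q R)"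
proof -
  have *: "disjnt (insert x q) (\<Union>R)"
    if P: "partition_on (insert x A) (insert (insert x q) R)"
  proof -
    have "disjnt (insert x q) r" if "r \<in> R" for r
      using partition_onD2[OF P] that assms(4) by (auto simp: pairwise_insert)
    then show ?thesis by (auto simp: disjnt_iff)
  qed
  have **: "disjnt (insert x q) (\<Union>R)" if P: "partition_on A (insert q R)"
  proof -
    have "disjnt (insert x q) r" if "r \<in> R" for r
      using partition_onD2[OF P] partition_onD1[OF P] that assms(1,5)
      by (auto simp: pairwise_insert)
    then show ?thesis by (auto simp: disjnt_iff)
  qed
  have ***: "partition_on (insert x A) (insert (insert x q) R) \<longleftrightarrow> partition_on A (insert q R)"
    if d: "disjnt (insert x q) (\<Union>R)"
  proof -
    have "disjnt q (\<Union>R)" using d by (simp add: disjnt_insert1)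
    moreover have "insert x A - insert x q = A - q" "insert x q \<subseteq> insert x A \<longleftrightarrow> q \<subseteq> A"
      using assms by auto
    ultimately show ?thesis
      using partition_on_insert[OF d, of "insert x A"] partition_on_insert[of q R A] assms(3) by simp
  qed
  show ?thesis using * ** *** by blast
qed

text \<open>
  The recurrence behind the Stirling numbers: a new element \<open>x\<close> is a block of its own or joins one
  of the existing blocks.
\<close>

lemma partitions_insert_Suc:
  assumes "finite A" "x \<notin> A"
  shows "{P. partition_on (insert x A) P \<and> card P = Suc k} =
      insert {x} ` {Q. partition_on A Q \<and> card Q = k} \<union>
      (\<lambda>(Q, q). insert (insert x q) (Q - {q})) ` (SIGMA Q:{Q. partition_on A Q \<and> card Q = Suc k}. Q)"
  (is "?L = ?R1 \<union> ?R2")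
proof (intro equalityI subsetI)
  fix P assume "P \<in> ?L"
  then have P: "partition_on (insert x A) P" "card P = Suc k" by auto
  then have finP: "finite P" using finite_elements assms(1) by blast
  obtain X where X: "X \<in> P" "x \<in> X" using P(1) unfolding partition_on_def by blast
  show "P \<in> ?R1 \<union> ?R2"
  proof (cases "X = {x}")
    case True
    then have "P = insert {x} (P - {{x}})" using X by auto
    moreover from this have "partition_on A (P - {{x}})"
      using partition_on_insert_singleton[OF assms(2), of "P - {{x}}"] P(1) by simp
    moreover have "card (P - {{x}}) = k" using P(2) finP X True by simp
    ultimately show ?thesis by blast
  next
    case False
    define q R where "q = X - {x}" and "R = P - {X}"
    have q: "q \<noteq> {}" "x \<notin> q" "insert x q = X" using False X unfolding q_def by auto
    have P_eq: "P = insert (insert x q) R" using X q unfolding R_def by auto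
    have "q \<notin> R"
    proof
      assume "q \<in> R"
      then have "q \<in> P" "q \<noteq> X" unfolding R_def by auto
      then show False
        using partition_on_block_unique[OF P(1) _ X(1)] q unfolding q_def by blast
    qed
    moreover have "insert x q \<notin> R" using q unfolding R_def by simp
    ultimately have "partition_on A (insert q R)"
      using partition_on_extend_block[OF assms(2) q(2,1)] P(1) P_eq by simp
    moreover have "card (insert q R) = Suc k"
      using \<open>q \<notin> R\<close> finP P(2) X(1) unfolding R_def by simp
    moreover have "P = insert (insert x q) (insert q R - {q})"
      using P_eq \<open>q \<notin> R\<close> by simp
    ultimately have "P \<in> ?R2"
      by (intro image_eqI[of _ _ "(insert q R, q)"]) auto
    then show ?thesis by blast
  qed
next
  fix P assume "P \<in> ?R1 \<union> ?R2"
  then show "P \<in> ?L"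
  proof
    assume "P \<in> ?R1"
    then obtain Q where Q: "partition_on A Q" "card Q = k" "P = insert {x} Q" by auto
    moreover have "finite Q" using finite_elements[OF assms(1) Q(1)] .
    ultimately show ?thesis
      using partition_on_insert_singleton[OF assms(2), of Q] by auto
  next
    assume "P \<in> ?R2"
    then obtain Q q where Q: "partition_on A Q" "card Q = Suc k" "q \<in> Q"
      and P: "P = insert (insert x q) (Q - {q})" by auto
    have "\<Union>Q = A" "{} \<notin> Q" using Q(1) unfolding partition_on_def by blast+
    then have *: "x \<notin> q" "q \<noteq> {}" "insert x q \<notin> Q" using Q(3) assms(2) by auto
    have "partition_on (insert x A) P"
      unfolding P using partition_on_extend_block[OF assms(2) *(1,2), of "Q - {q}"] * Q
      by (simp add: insert_absorb)
    moreover have "card P = Suc k"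
      unfolding P using Q * finite_elements[OF assms(1) Q(1)] by simp
    ultimately show ?thesis by simp
  qed
qed

lemma card_partitions_eq_Stirling:
  assumes "finite A"
  shows "card {P. partition_on A P \<and> card P = k} = Stirling (card A) k"
  using assms
proof (induction A arbitrary: k rule: finite_induct)
  case empty
  have "{P. partition_on {} P \<and> card P = k} = (if k = 0 then {{}} else {})"
    by (auto simp: partition_on_empty)
  then show ?case unfolding \<open>{P. partition_on {} P \<and> card P = k} = _\<close> by (cases k) simp_all
next
  case (insert x A)
  show ?case
  proof (cases k)
    case 0
    have "card P \<noteq> k" if P: "partition_on (insert x A) P" for P
    proof -
      have "x \<in> \<Union>P" using partition_onD1[OF P] by (metis insertI1)
      then have "P \<noteq> {}" by (metis Union_empty empty_iff)
      moreover have "finite P" using finite_elements[OF _ P] insert.hyps(1) by simp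
      ultimately show ?thesis using 0 by simp
    qed
    then have "{P. partition_on (insert x A) P \<and> card P = k} = {}" by blast
    then have "card {P. partition_on (insert x A) P \<and> card P = k} = 0" by (simp only: card.empty)
    then show ?thesis using 0 insert.hyps by simp
  next
    case (Suc m)
    let ?P = "\<lambda>k. {P. partition_on A P \<and> card P = k}"
    let ?glue = "\<lambda>(Q, q). insert (insert x q) (Q - {q})"
    have fin: "finite (?P k)" for k
      using finitely_many_partition_on[OF insert.hyps(1)] by simp
    have finQ: "finite Q" if "Q \<in> ?P k" for Q k
      using that finite_elements insert.hyps(1) by auto
    have notin: "x \<notin> q" "q \<noteq> {}" if "Q \<in> ?P k" "q \<in> Q" for Q q k
      using that insert.hyps(2) unfolding partition_on_def by auto
    have inj1: "inj_on (insert {x}) (?P m)"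
    proof (rule inj_onI)
      fix Q Q' assume "Q \<in> ?P m" "Q' \<in> ?P m" and eq: "insert {x} Q = insert {x} Q'"
      then have "{x} \<notin> Q" "{x} \<notin> Q'" using notin(1) by blast+
      with eq show "Q = Q'" by (simp add: insert_ident)
    qed
    have inj2: "inj_on ?glue (SIGMA Q:?P (Suc m). Q)"
    proof (rule inj_onI, clarify)
      fix Q q Q' q'
      assume Q: "partition_on A Q" "card Q = Suc m" "q \<in> Q"
        and Q': "partition_on A Q'" "card Q' = Suc m" "q' \<in> Q'"
        and eq: "insert (insert x q) (Q - {q}) = insert (insert x q') (Q' - {q'})"
      have n: "x \<notin> r" if "r \<in> Q \<union> Q'" for r using that notin(1) Q Q' by blast
      have "insert x q \<in> insert (insert x q') (Q' - {q'})" using eq by blast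
      then have "insert x q = insert x q'" using n by blast
      then have q: "q = q'" using n Q(3) Q'(3) by (metis UnI1 UnI2 insert_ident)
      have "insert x q \<notin> Q - {q}" "insert x q \<notin> Q' - {q'}" using n by blast+
      then have "Q - {q} = Q' - {q'}" using eq q by (metis insert_ident)
      then show "Q = Q' \<and> q = q'" using q Q(3) Q'(3) by blast
    qed
    have disj: "insert {x} ` ?P m \<inter> ?glue ` (SIGMA Q:?P (Suc m). Q) = {}"
    proof -
      have "{x} \<notin> ?glue (Q, q)" if "Q \<in> ?P (Suc m)" "q \<in> Q" for Q q
        using notin[OF that] notin(1)[OF that(1)] by auto
      then have "{x} \<notin> P" if "P \<in> ?glue ` (SIGMA Q:?P (Suc m). Q)" for P
        using that by (elim imageE SigmaE) (simp only: simp_thms)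
      moreover have "{x} \<in> P" if "P \<in> insert {x} ` ?P m" for P using that by auto
      ultimately show ?thesis by (meson disjoint_iff)
    qed
    have "card {P. partition_on (insert x A) P \<and> card P = k}
        = card (insert {x} ` ?P m) + card (?glue ` (SIGMA Q:?P (Suc m). Q))"
      unfolding Suc partitions_insert_Suc[OF insert.hyps]
      by (intro card_Un_disjoint finite_imageI finite_SigmaI disj fin finQ)
    also have "card (insert {x} ` ?P m) = Stirling (card A) m"
      using card_image[OF inj1] insert.IH by simp
    also have "card (?glue ` (SIGMA Q:?P (Suc m). Q)) = (\<Sum>Q\<in>?P (Suc m). card Q)"
      unfolding card_image[OF inj2] by (intro card_SigmaI ballI fin finQ)
    also have "\<dots> = Suc m * Stirling (card A) (Suc m)"
      using insert.IH[of "Suc m"] by simp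
    finally show ?thesis using Suc insert.hyps by simp
  qed
qed

section \<open>Connecting partitions as matched pairs of partitions\<close>

text \<open>
  For \<open>A = {1..l}\<close> and \<open>B = {l..n}\<close> these are the \<open>l\<close>-connecting partitions of \<open>{1..n}\<close>. The
  symmetric form lets each argument about \<open>A\<close> serve for \<open>B\<close> as well.
\<close>

definition linked_partition :: "'a set \<Rightarrow> 'a set \<Rightarrow> 'a set set \<Rightarrow> bool" where
  "linked_partition A B P \<longleftrightarrow>
     partition_on (A \<union> B) P \<and> (\<forall>X\<in>P. X \<inter> A \<noteq> {} \<and> X \<inter> B \<noteq> {})"

lemma linked_partition_commute: "linked_partition A B P \<longleftrightarrow> linked_partition B A P"
  by (auto simp: linked_partition_def Un_commute)

text \<open>
  Since every block meets \<open>A\<close>, restricting to \<open>A\<close> produces no empty block and merges no two blocks.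
\<close>

lemma linked_partition_restrict:
  assumes "linked_partition A B P"
  shows "partition_on A ((\<lambda>X. X \<inter> A) ` P)" "inj_on (\<lambda>X. X \<inter> A) P"
    "partition_on B ((\<lambda>X. X \<inter> B) ` P)" "inj_on (\<lambda>X. X \<inter> B) P"
proof -
  have *: "partition_on A ((\<lambda>X. X \<inter> A) ` P) \<and> inj_on (\<lambda>X. X \<inter> A) P"
    if L: "linked_partition A B P" for A B
  proof
    have P: "partition_on (A \<union> B) P" and ne: "\<And>X. X \<in> P \<Longrightarrow> X \<inter> A \<noteq> {}"
      using L unfolding linked_partition_def by auto
    have "(\<inter>) A ` P - {{}} = (\<lambda>X. X \<inter> A) ` P" using ne by (force simp: Int_commute)
    then show "partition_on A ((\<lambda>X. X \<inter> A) ` P)"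
      using partition_on_restrict[OF P, of A] by (simp add: Int_absorb2)
    show "inj_on (\<lambda>X. X \<inter> A) P"
    proof (rule inj_onI)
      fix X Y assume XY: "X \<in> P" "Y \<in> P" "X \<inter> A = Y \<inter> A"
      obtain a where "a \<in> X \<inter> A" using ne[OF XY(1)] by blast
      moreover from this have "a \<in> Y \<inter> A" using XY(3) by simp
      ultimately show "X = Y" using partition_on_block_unique[OF P XY(1,2), of a] by simp
    qed
  qed
  show "partition_on A ((\<lambda>X. X \<inter> A) ` P)" "inj_on (\<lambda>X. X \<inter> A) P"
    "partition_on B ((\<lambda>X. X \<inter> B) ` P)" "inj_on (\<lambda>X. X \<inter> B) P"
    using *[OF assms] *[OF assms[unfolded linked_partition_commute[of A B]]] by simp_all
qed

lemma card_injections_same_card: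
  assumes "finite A" "finite B" "card A = card B"
  shows "card {h \<in> A \<rightarrow>\<^sub>E B. inj_on h A} = fact (card A)"
  using card_inj_on_subset_funcset[OF assms(1,2) order_refl] assms(3)
  by (simp add: fact_prod_rev)

text \<open>
  Partitions of \<open>A\<close> and \<open>B\<close> may be glued along any matching of their blocks that pairs the two
  blocks containing the common point \<open>p\<close>. This condition is what makes \<open>q\<close> recoverable from \<open>q \<union> h q\<close>: the
  sets \<open>A\<close> and \<open>B\<close> share only \<open>p\<close>, so \<open>h q\<close> can contribute to \<open>A\<close> no point except \<open>p\<close>, which then
  lies in \<open>q\<close> already.
\<close>

lemma glued_blocks:
  assumes AB: "A \<inter> B = {p}" and Q1: "partition_on A Q1" and Q2: "partition_on B Q2"
    and h: "bij_betw h Q1 Q2" and b: "b \<in> Q1" "p \<in> b" "p \<in> h b"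
  shows "q \<in> Q1 \<Longrightarrow> (q \<union> h q) \<inter> A = q" "q \<in> Q1 \<Longrightarrow> (q \<union> h q) \<inter> B = h q"
    "linked_partition A B ((\<lambda>q. q \<union> h q) ` Q1)"
proof -
  have hQ: "h q \<in> Q2" if "q \<in> Q1" for q using that h bij_betwE by blast
  have sub: "q \<subseteq> A" "q \<noteq> {}" "h q \<subseteq> B" "h q \<noteq> {}" if "q \<in> Q1" for q
    using that hQ[OF that] partition_onD1[OF Q1] partition_onD3[OF Q1]
      partition_onD1[OF Q2] partition_onD3[OF Q2] by auto
  have p: "p \<in> q \<longleftrightarrow> p \<in> h q" if q: "q \<in> Q1" for q
  proof
    assume "p \<in> q"
    then have "q = b" using partition_on_block_unique[OF Q1 q b(1) _ b(2)] by simp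
    then show "p \<in> h q" using b by simp
  next
    assume "p \<in> h q"
    then have "h q = h b"
      using partition_on_block_unique[OF Q2 hQ[OF q] hQ[OF b(1)] _ b(3)] by simp
    then have "q = b" using inj_onD[OF bij_betw_imp_inj_on[OF h] _ q b(1)] by simp
    then show "p \<in> q" using b by simp
  qed
  have eq_p: "x = p" if "x \<in> A" "x \<in> B" for x using that AB by (metis IntI singletonD)
  show A: "(q \<union> h q) \<inter> A = q" if "q \<in> Q1" for q
    using sub(1,3)[OF that] p[OF that] eq_p by (auto simp: subset_iff)
  show B: "(q \<union> h q) \<inter> B = h q" if "q \<in> Q1" for q
    using sub(1,3)[OF that] p[OF that] eq_p by (auto simp: subset_iff)
  show "linked_partition A B ((\<lambda>q. q \<union> h q) ` Q1)"
    unfolding linked_partition_def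
  proof
    show "\<forall>X\<in>(\<lambda>q. q \<union> h q) ` Q1. X \<inter> A \<noteq> {} \<and> X \<inter> B \<noteq> {}"
      using A B sub by simp
    show "partition_on (A \<union> B) ((\<lambda>q. q \<union> h q) ` Q1)"
    proof (rule partition_onI)
      have "\<Union>(h ` Q1) = B" "\<Union>Q1 = A"
        using bij_betw_imp_surj_on[OF h] partition_onD1[OF Q1] partition_onD1[OF Q2] by simp_all
      then show "\<Union>((\<lambda>q. q \<union> h q) ` Q1) = A \<union> B" by blast
      show "{} \<notin> (\<lambda>q. q \<union> h q) ` Q1" using sub by auto
      fix X Y assume "X \<in> (\<lambda>q. q \<union> h q) ` Q1" "Y \<in> (\<lambda>q. q \<union> h q) ` Q1" and ne: "X \<noteq> Y"
      then obtain q r where q: "q \<in> Q1" "X = q \<union> h q" and r: "r \<in> Q1" "Y = r \<union> h r" by blast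
      then have "q \<noteq> r" using ne by blast
      then have "h q \<noteq> h r" using inj_onD[OF bij_betw_imp_inj_on[OF h] _ q(1) r(1)] by blast
      have "X \<inter> A \<inter> (Y \<inter> A) = {}"
        unfolding q(2) r(2) A[OF q(1)] A[OF r(1)]
        using \<open>q \<noteq> r\<close> partition_on_block_unique[OF Q1 q(1) r(1)] by blast
      moreover have "X \<inter> B \<inter> (Y \<inter> B) = {}"
        unfolding q(2) r(2) B[OF q(1)] B[OF r(1)]
        using \<open>h q \<noteq> h r\<close> partition_on_block_unique[OF Q2 hQ[OF q(1)] hQ[OF r(1)]] by blast
      moreover have "X \<subseteq> A \<union> B" using q(2) sub[OF q(1)] by blast
      ultimately show "disjnt X Y" unfolding disjnt_def by blast
    qed
  qed
qed

text \<open>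
  With both restrictions prescribed, a linked partition is a matching of their blocks. One pair is
  forced by the common point, and the other \<open>j\<close> blocks of \<open>A\<close> can be matched with the other \<open>j\<close>
  blocks of \<open>B\<close> in any way.
\<close>

lemma card_linked_partitions_over:
  assumes fin: "finite A" "finite B" and AB: "A \<inter> B = {p}"
    and Q1: "partition_on A Q1" "card Q1 = Suc j" and Q2: "partition_on B Q2" "card Q2 = Suc j"
  shows "card {P. linked_partition A B P \<and> (\<lambda>X. X \<inter> A) ` P = Q1 \<and> (\<lambda>X. X \<inter> B) ` P = Q2} = fact j"
proof -
  let ?G = "{P. linked_partition A B P \<and> (\<lambda>X. X \<inter> A) ` P = Q1 \<and> (\<lambda>X. X \<inter> B) ` P = Q2}"
  have finQ: "finite Q1" "finite Q2" using finite_elements fin Q1(1) Q2(1) by blast+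
  obtain b1 b2 where b1: "b1 \<in> Q1" "p \<in> b1" and b2: "b2 \<in> Q2" "p \<in> b2"
  proof -
    have "p \<in> \<Union>Q1" "p \<in> \<Union>Q2" using AB partition_onD1[OF Q1(1)] partition_onD1[OF Q2(1)] by auto
    then show thesis using that by auto
  qed
  \<comment> \<open>Matchings of the free blocks; \<open>?match\<close> completes them by the forced pair.\<close>
  let ?H = "{h \<in> (Q1 - {b1}) \<rightarrow>\<^sub>E (Q2 - {b2}). inj_on h (Q1 - {b1})}"
  let ?match = "\<lambda>h. h(b1 := b2)"
  let ?glue = "\<lambda>h. (\<lambda>q. q \<union> ?match h q) ` Q1"
  have bij: "bij_betw (?match h) Q1 Q2" if h: "h \<in> ?H" for h
  proof -
    have "h ` (Q1 - {b1}) = Q2 - {b2}"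
      using h finQ Q1(2) Q2(2) b1(1) b2(1)
      by (intro card_subset_eq) (auto simp: card_image)
    then have "bij_betw h (Q1 - {b1}) (Q2 - {b2})" using h by (simp add: bij_betw_def)
    then have "bij_betw (?match h) (Q1 - {b1}) (Q2 - {b2})"
      by (rule bij_betw_cong[THEN iffD1, rotated]) simp
    moreover have "bij_betw (?match h) {b1} {b2}" by (simp add: bij_betw_def)
    ultimately have "bij_betw (?match h) ((Q1 - {b1}) \<union> {b1}) ((Q2 - {b2}) \<union> {b2})"
      by (rule bij_betw_combine) simp
    then show ?thesis using b1(1) b2(1) by (simp add: insert_absorb)
  qed
  note glued = glued_blocks[OF AB Q1(1) Q2(1) bij b1, simplified fun_upd_same, OF _ b2(2)]
  have "bij_betw ?glue ?H ?G"
    unfolding bij_betw_def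
  proof (intro conjI inj_onI equalityI subsetI)
    fix g h assume g: "g \<in> ?H" and h: "h \<in> ?H" and eq: "?glue g = ?glue h"
    show "g = h"
    proof (rule PiE_ext)
      show "g \<in> (Q1 - {b1}) \<rightarrow>\<^sub>E (Q2 - {b2})" "h \<in> (Q1 - {b1}) \<rightarrow>\<^sub>E (Q2 - {b2})" using g h by auto
      fix q assume q: "q \<in> Q1 - {b1}"
      have "q \<union> ?match g q \<in> ?glue h" using q eq[symmetric] by blast
      then obtain r where r: "r \<in> Q1" "q \<union> ?match g q = r \<union> ?match h r" by blast
      then have "q = r" using glued(1)[OF g, of q] glued(1)[OF h, of r] q by auto
      then have "?match g q = ?match h q"
        using glued(2)[OF g, of q] glued(2)[OF h, of r] q r by auto
      then show "g q = h q" using q by simp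
    qed
  next
    fix P assume "P \<in> ?glue ` ?H"
    then obtain h where h: "h \<in> ?H" and P: "P = ?glue h" by blast
    have "(\<lambda>X. X \<inter> A) ` P = Q1"
      unfolding P image_image using glued(1)[OF h] by simp
    moreover have "(\<lambda>X. X \<inter> B) ` P = ?match h ` Q1"
      unfolding P image_image by (rule image_cong[OF refl]) (rule glued(2)[OF h])
    ultimately show "P \<in> ?G"
      using glued(3)[OF h] bij[OF h] P by (simp add: bij_betw_def)
  next
    fix P assume "P \<in> ?G"
    then have P: "linked_partition A B P" and PA: "(\<lambda>X. X \<inter> A) ` P = Q1"
      and PB: "(\<lambda>X. X \<inter> B) ` P = Q2" by auto
    \<comment> \<open>\<open>e q\<close> is the block of \<open>P\<close> that extends \<open>q\<close>.\<close>
    define e where "e = inv_into P (\<lambda>X. X \<inter> A)"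
    note inj = linked_partition_restrict(2,4)[OF P]
    have e: "e q \<in> P" "e q \<inter> A = q" if "q \<in> Q1" for q
      using that f_inv_into_f[of q "\<lambda>X. X \<inter> A" P] inv_into_into[of q "\<lambda>X. X \<inter> A" P]
      unfolding e_def PA by blast+
    have eQ: "e ` Q1 = P"
      unfolding e_def PA[symmetric] by (rule inv_into_image_cancel[OF inj(1) order_refl, THEN trans]) simp
    have eB: "e q \<inter> B \<in> Q2" if "q \<in> Q1" for q using e(1)[OF that] PB by blast
    have e_inj: "q = r" if "q \<in> Q1" "r \<in> Q1" "e q \<inter> B = e r \<inter> B" for q r
      using that e inj(2) unfolding inj_on_def by metis
    have "p \<in> e b1 \<inter> B" using e(2)[OF b1(1)] b1(2) AB by blast
    then have eb: "e b1 \<inter> B = b2"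
      using partition_on_block_unique[OF Q2(1) eB[OF b1(1)] b2(1) _ b2(2)] by blast
    define h where "h = restrict (\<lambda>q. e q \<inter> B) (Q1 - {b1})"
    have "h \<in> ?H"
    proof -
      have "e q \<inter> B \<noteq> b2" if "q \<in> Q1 - {b1}" for q
        using that e_inj[of q b1] b1(1) eb by auto
      then show ?thesis unfolding h_def using eB e_inj by (auto simp: inj_on_def)
    qed
    moreover have "?glue h = P"
    proof -
      have "q \<union> ?match h q = e q" if q: "q \<in> Q1" for q
      proof -
        have "?match h q = e q \<inter> B" using q eb unfolding h_def by auto
        moreover have "e q \<subseteq> A \<union> B" using e(1)[OF q] P partition_onD1[of "A \<union> B" P]
          unfolding linked_partition_def by auto
        ultimately show ?thesis using e(2)[OF q] by blast
      qed
      then have "?glue h = e ` Q1" by (rule image_cong[OF refl])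
      then show ?thesis using eQ by simp
    qed
    ultimately show "P \<in> ?glue ` ?H" by (metis (no_types, lifting) image_eqI)
  qed
  then have "card ?G = card ?H" by (simp add: bij_betw_same_card)
  also have "\<dots> = fact (card (Q1 - {b1}))"
    by (rule card_injections_same_card) (use finQ Q1(2) Q2(2) b1(1) b2(1) in auto)
  also have "\<dots> = fact j" using finQ Q1(2) b1(1) by simp
  finally show ?thesis .
qed

text \<open>
  Linked partitions with \<open>j + 1\<close> blocks are sorted by their two restrictions, each a partition into
  \<open>j + 1\<close> blocks.
\<close>

lemma card_linked_partitions:
  assumes fin: "finite A" "finite B" and AB: "A \<inter> B = {p}" and cA: "card A = Suc k"
  shows "card {P. linked_partition A B P} =
    (\<Sum>j\<le>k. Stirling (card A) (Suc j) * Stirling (card B) (Suc j) * fact j)"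
proof -
  let ?Q = "\<lambda>A j. {Q. partition_on A Q \<and> card Q = Suc j}"
  let ?L = "\<lambda>j. {P. linked_partition A B P \<and> card P = Suc j}"
  let ?G = "\<lambda>Q1 Q2. {P. linked_partition A B P \<and> (\<lambda>X. X \<inter> A) ` P = Q1 \<and> (\<lambda>X. X \<inter> B) ` P = Q2}"
  have finL: "finite {P. linked_partition A B P}"
    by (rule finite_subset[OF _ finitely_many_partition_on[of "A \<union> B"]])
      (use fin in \<open>auto simp: linked_partition_def\<close>)
  have finQ: "finite (?Q A j)" "finite (?Q B j)" for j
    using finitely_many_partition_on[OF fin(1)] finitely_many_partition_on[OF fin(2)] by simp_all
  \<comment> \<open>The restriction to \<open>A\<close> is a partition of \<open>k + 1\<close> points into \<open>card P\<close> blocks, so the corresponding Stirling number is nonzero.\<close>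
  have "card P \<in> Suc ` {..k}" if P: "linked_partition A B P" for P
  proof -
    let ?R = "(\<lambda>X. X \<inter> A) ` P"
    note R = linked_partition_restrict(1,2)[OF P]
    have "?R \<in> {Q. partition_on A Q \<and> card Q = card P}"
      using R card_image[OF R(2)] by simp
    moreover have "finite {Q. partition_on A Q \<and> card Q = card P}"
      using finitely_many_partition_on[OF fin(1)] by simp
    ultimately have "card {Q. partition_on A Q \<and> card Q = card P} \<noteq> 0" by (metis card_0_eq empty_iff)
    then have S: "Stirling (Suc k) (card P) \<noteq> 0"
      unfolding card_partitions_eq_Stirling[OF fin(1)] cA .
    then obtain j where "card P = Suc j" by (cases "card P") simp_all
    moreover have "card P \<le> Suc k" using S Stirling_less not_less by blast
    ultimately show ?thesis by simp
  qed
  then have split: "{P. linked_partition A B P} = (\<Union>j\<in>{..k}. ?L j)" by blast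
  have L: "card (?L j) = Stirling (card A) (Suc j) * Stirling (card B) (Suc j) * fact j" for j
  proof -
    have "?L j = (\<Union>(Q1, Q2)\<in>?Q A j \<times> ?Q B j. ?G Q1 Q2)"
    proof (intro equalityI subsetI)
      fix P assume "P \<in> ?L j"
      then have P: "linked_partition A B P" "card P = Suc j" by auto
      note R = linked_partition_restrict[OF P(1)]
      show "P \<in> (\<Union>(Q1, Q2)\<in>?Q A j \<times> ?Q B j. ?G Q1 Q2)"
        using R(1,3) card_image[OF R(2)] card_image[OF R(4)] P by auto
    next
      fix P assume "P \<in> (\<Union>(Q1, Q2)\<in>?Q A j \<times> ?Q B j. ?G Q1 Q2)"
      then have P: "linked_partition A B P" "card ((\<lambda>X. X \<inter> A) ` P) = Suc j" by auto
      then show "P \<in> ?L j" using card_image[OF linked_partition_restrict(2)[OF P(1)]] by simp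
    qed
    moreover have "card (\<Union>(Q1, Q2)\<in>?Q A j \<times> ?Q B j. ?G Q1 Q2)
        = (\<Sum>x\<in>?Q A j \<times> ?Q B j. card (case x of (Q1, Q2) \<Rightarrow> ?G Q1 Q2))"
      by (rule card_UN_disjoint) (use finQ finL in auto)
    moreover have "\<dots> = (\<Sum>x\<in>?Q A j \<times> ?Q B j. fact j)"
      by (rule sum.cong[OF refl]) (use card_linked_partitions_over[OF fin AB] in auto)
    moreover have "\<dots> = Stirling (card A) (Suc j) * Stirling (card B) (Suc j) * fact j"
      using card_partitions_eq_Stirling[OF fin(1)] card_partitions_eq_Stirling[OF fin(2)]
      by (simp only: sum_constant card_cartesian_product of_nat_id)
    ultimately show ?thesis by simp
  qed
  have "card {P. linked_partition A B P} = (\<Sum>j\<le>k. card (?L j))"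
    unfolding split by (rule card_UN_disjoint) (use finL in auto)
  then show ?thesis using L by simp
qed

lemma connecting_iff_linked:
  assumes "1 \<le> l" "l \<le> n"
  shows "partition_on {1..n} P \<and> connecting l P \<longleftrightarrow> linked_partition {1..l} {l..n} P"
proof -
  have "{1..l} \<union> {l..n} = {1..n}" using assms by auto
  moreover have "Min X \<le> l \<and> l \<le> Max X \<longleftrightarrow> X \<inter> {1..l} \<noteq> {} \<and> X \<inter> {l..n} \<noteq> {}"
    if P: "partition_on {1..n} P" and X: "X \<in> P" for X
  proof -
    have X': "X \<subseteq> {1..n}" "X \<noteq> {}" using P X unfolding partition_on_def by auto
    then have "finite X" using finite_subset by blast
    then have "Min X \<le> l \<longleftrightarrow> (\<exists>x\<in>X. x \<le> l)" "l \<le> Max X \<longleftrightarrow> (\<exists>x\<in>X. l \<le> x)"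
      using X'(2) by (auto simp: Min_le_iff Max_ge_iff)
    then show ?thesis using X'(1) by fastforce
  qed
  ultimately show ?thesis unfolding connecting_def linked_partition_def by auto
qed


theorem theorem19:
  fixes k1 k2 :: nat
  shows "((\<lambda>\<mu>. num_tableaux k1 \<mu> * num_tableaux k2 \<mu>) has_sum
           card {P. partition_on {1..k1 + k2 + 1} P \<and> connecting (k1 + 1) P})
         {\<mu>. integer_partition \<mu>}"
proof -
  let ?A = "{1..k1 + 1}" and ?B = "{k1 + 1..k1 + k2 + 1}"
  have "?A \<inter> ?B = {k1 + 1}" by auto
  moreover have "card ?A = Suc k1" "card ?B = Suc k2" by simp_all
  ultimately have "card {P. linked_partition ?A ?B P} =
      (\<Sum>j\<le>k1. Stirling (Suc k1) (Suc j) * Stirling (Suc k2) (Suc j) * fact j)"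
    using card_linked_partitions[of ?A ?B "k1 + 1" k1] by simp
  then have "card {P. partition_on {1..k1 + k2 + 1} P \<and> connecting (k1 + 1) P} =
      (\<Sum>j\<le>k1. Stirling (Suc k1) (Suc j) * Stirling (Suc k2) (Suc j) * fact j)"
    by (subst connecting_iff_linked) auto
  then show ?thesis using sum_num_tableaux[of k1 k2] by simp
qed

end
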